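(* Let $f=(f_0,f_1,f_2,\dots)\in\{1,-1\}^{\mathbb{N}}$ be any folding instruction sequence and let $n\ge7$, with $\phi(n)=2^k$. Then $$S_f(n)=\begin{cases}4\cdot\phi(n), & \text{if } f_{k+1}\neq f_{k+2},\\ 6\cdot\phi(n), & \text{if } f_{k+1}=f_{k+2}.\end{cases}$$
   Context: A folding instruction sequence is an infinite sequence $f=(f_0,f_1,\dots)$ with each $f_i\in\{1,-1\}$ (indexed from $0$). The paper-folding sequence $P_f=P_f[1],P_f[2],\dots$ (indexed from $1$) is defined by: for $m\ge1$ write $m=2^s r$ with $r$ odd; $P_f[m]=f_s$ if $r\equiv 1\pmod 4$ and $P_f[m]=-f_s$ if $r\equiv3\pmod4$. $P_f[i:j]$ denotes $P_f[i]\cdots P_f[j]$. A length-$n$ factor of $P_f$ is a word of the form $P_f[i:i+n-1]$, $i\ge1$. $S_f(n)$ is the least integer $K$ such that every length-$n$ factor $w$ of $P_f$ satisfies $w=P_f[i:i+n-1]$ for some $1\le i\le K$. $\phi(n)$ is the least power of $2$ that is $\ge n$, i.e. $\phi(n)=2^{\lceil \log_2 n\rceil}$. *)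

theory Defs
  imports "HOL-Computational_Algebra.Computational_Algebra"
begin

definition folding_instructions :: "(nat \<Rightarrow> int) \<Rightarrow> bool" where
  "folding_instructions f \<longleftrightarrow> (\<forall>i. f i \<in> {1, -1})"

(* Indexed from 1; the value at m = 0 is irrelevant. For m > 0 the odd part r = m div 2 ^ s
   is congruent to 1 or 3 modulo 4, so the else branch is exactly the case r = 3 (mod 4). *)
definition paperfold :: "(nat \<Rightarrow> int) \<Rightarrow> nat \<Rightarrow> int" where
  "paperfold f m =
    (let s = multiplicity 2 m; r = m div 2 ^ s
     in if r mod 4 = 1 then f s else - f s)"

(* The word P_f[i : j], both ends inclusive. *)
definition pf_word :: "(nat \<Rightarrow> int) \<Rightarrow> nat \<Rightarrow> nat \<Rightarrow> int list" where
  "pf_word f i j = map (paperfold f) [i..<Suc j]"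

definition pf_factors :: "(nat \<Rightarrow> int) \<Rightarrow> nat \<Rightarrow> int list set" where
  "pf_factors f n = {pf_word f i (i + n - 1) | i. 1 \<le> i}"

(* K ranges over the naturals: a factor of length n always exists and occurs only at
   positions i >= 1, so no integer K < 1 qualifies. *)
definition S_fun :: "(nat \<Rightarrow> int) \<Rightarrow> nat \<Rightarrow> nat" where
  "S_fun f n = (LEAST K. \<forall>w \<in> pf_factors f n. \<exists>i. 1 \<le> i \<and> i \<le> K \<and> w = pf_word f i (i + n - 1))"

definition phi :: "nat \<Rightarrow> nat" where
  "phi n = (LEAST m. (\<exists>k. m = 2 ^ k) \<and> n \<le> m)"

end

theory Submission
  imports Defs
begin

text \<open>
  Put \<open>N = 2 ^ k\<close>. Letters at non-multiples of \<open>N\<close> depend only on the position modulo \<open>2 * N\<close>,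
  and a window of length \<open>n \<le> N\<close> contains at most one multiple \<open>j * N\<close>. If \<open>j\<close> is odd, both signs of
  that letter occur for \<open>j = 1, 3\<close>; if \<open>j\<close> is even, \<open>j = 2, 4, 6\<close> give \<open>f (k+1)\<close>, \<open>f (k+2)\<close> and
  \<open>- f (k+1)\<close>. This bounds the starting positions that are needed. Conversely, a factor of length
  \<open>n > N / 2\<close>, \<open>n \<ge> 7\<close>, that starts at a multiple of \<open>2 * N\<close> can only recur at multiples of
  \<open>2 * N\<close>, so the factor starting at \<open>4 * N\<close> (respectively \<open>6 * N\<close>) does not occur earlier, since its
  first letter differs from the letters at the smaller multiples of \<open>2 * N\<close>.
\<close>

lemma multiplicity_two_power_mult_odd:
  fixes r :: nat
  assumes "odd r"
  shows "multiplicity 2 (2 ^ s * r) = s"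
  using assms by (intro multiplicity_eqI) auto

lemma paperfold_power_mult_odd:
  assumes "odd r"
  shows "paperfold f (2 ^ s * r) = (if r mod 4 = 1 then f s else - f s)"
  using multiplicity_two_power_mult_odd[OF assms, of s] by (simp add: paperfold_def Let_def)

lemma paperfold_one_mod_four: "paperfold f (2 ^ s * (4 * q + 1)) = f s"
  by (subst paperfold_power_mult_odd) auto

lemma paperfold_three_mod_four: "paperfold f (2 ^ s * (4 * q + 3)) = - f s"
proof -
  have "(4 * q + 3) mod 4 = 3" by presburger
  then show ?thesis by (subst paperfold_power_mult_odd) auto
qed

lemma nat_eq_power_two_mult_odd:
  fixes m :: nat
  assumes "m > 0"
  obtains s r where "m = 2 ^ s * r" and "odd r"
proof (rule multiplicity_decompose'[of m 2])
  show "m \<noteq> 0" using assms by simp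
  show "\<not> is_unit (2::nat)" by simp
qed (rule that)

text \<open>If \<open>m = 2 ^ s * r\<close> with \<open>r\<close> odd, then \<open>s < k\<close>, so
  the shift adds a multiple of 4 to \<open>r\<close>: neither the exponent nor the class of
  \<open>r\<close> modulo 4 changes.\<close>

lemma paperfold_add_period:
  assumes "\<not> 2 ^ k dvd m"
  shows "paperfold f (m + 2 ^ (k + 1) * t) = paperfold f m"
proof -
  have "m > 0" using assms by (cases m) auto
  then obtain s r where m: "m = 2 ^ s * r" and r: "odd r"
    by (rule nat_eq_power_two_mult_odd)
  have "s < k"
    using assms le_imp_power_dvd[of k s "2::nat"] by (metis m dvd_mult2 not_less)
  then obtain d where k: "k = s + 1 + d"
    using less_imp_Suc_add[of s k] by fastforce
  have "m + 2 ^ (k + 1) * t = 2 ^ s * (r + 4 * (2 ^ d * t))"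
    by (simp add: m k power_add algebra_simps)
  then show ?thesis using r m by (simp add: paperfold_power_mult_odd)
qed

lemma pf_word_eq_iff:
  assumes "n \<ge> 1"
  shows "pf_word f i (i + n - 1) = pf_word f j (j + n - 1) \<longleftrightarrow>
    (\<forall>d<n. paperfold f (i + d) = paperfold f (j + d))"
  using assms by (simp add: pf_word_def list_eq_iff_nth_eq nth_append del: upt_Suc)

lemma phi_eq_powerD:
  assumes "phi n = 2 ^ k"
  shows "n \<le> 2 ^ k" and "j < k \<Longrightarrow> 2 ^ j < n"
proof -
  \<comment> \<open>The power \<open>2 ^ n\<close> shows that the \<open>LEAST\<close> in
    \<open>phi\<close> ranges over a nonempty set.\<close>
  have "(\<exists>k. (2::nat) ^ n = 2 ^ k) \<and> n \<le> 2 ^ n"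
    using less_exp[of n] by (auto intro: less_imp_le)
  then have "(\<exists>k. phi n = 2 ^ k) \<and> n \<le> phi n"
    unfolding phi_def by (rule LeastI)
  then show "n \<le> 2 ^ k" using assms by simp
  assume "j < k"
  then have "(2::nat) ^ j < phi n" using assms by simp
  then show "2 ^ j < n"
    unfolding phi_def using not_less_Least not_le by blast
qed

text \<open>Two multiples of \<open>2 ^ k\<close> inside a window of length at most
  \<open>2 ^ k\<close> coincide. So \<open>c\<close> is the only offset whose letter periodicity
  leaves open, and comparing the two words reduces to comparing that letter.\<close>

lemma pf_word_eq_shift:
  assumes n: "1 \<le> n" "n \<le> 2 ^ k"
    and c: "c < n" "2 ^ k dvd i + c"
    and eq: "paperfold f (i + c + 2 ^ (k + 1) * t) = paperfold f (i + c + 2 ^ (k + 1) * u)"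
  shows "pf_word f (i + 2 ^ (k + 1) * t) (i + 2 ^ (k + 1) * t + n - 1) =
    pf_word f (i + 2 ^ (k + 1) * u) (i + 2 ^ (k + 1) * u + n - 1)"
proof -
  have "paperfold f (i + d + 2 ^ (k + 1) * t) = paperfold f (i + d + 2 ^ (k + 1) * u)"
    if d: "d < n" for d
  proof (cases "2 ^ k dvd i + d")
    case True
    have "2 ^ k dvd (if c \<le> d then d - c else c - d)"
      using dvd_diff_nat[OF True c(2)] dvd_diff_nat[OF c(2) True] by auto
    moreover have "(if c \<le> d then d - c else c - d) < 2 ^ k"
      using d c n by auto
    ultimately have "(if c \<le> d then d - c else c - d) = 0"
      using nat_dvd_not_less by blast
    then have "d = c" by (auto split: if_splits)
    then show ?thesis using eq by simp
  next
    case False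
    then show ?thesis by (metis paperfold_add_period)
  qed
  then show ?thesis
    unfolding pf_word_eq_iff[OF n(1)] by (simp add: ac_simps del: power_Suc)
qed

lemma pf_word_recurs_early:
  assumes f: "folding_instructions f" and n: "1 \<le> n" "n \<le> 2 ^ k" and i: "i \<ge> 1"
  shows "\<exists>j. 1 \<le> j \<and> j \<le> (if f (k + 1) \<noteq> f (k + 2) then 4 * 2 ^ k else 6 * 2 ^ k) \<and>
    pf_word f i (i + n - 1) = pf_word f j (j + n - 1)"
proof -
  define K :: nat where "K = (if f (k + 1) \<noteq> f (k + 2) then 4 * 2 ^ k else 6 * 2 ^ k)"
  define N :: nat where "N = 2 ^ k"
  \<comment> \<open>The residue \<open>a\<close> is taken in \<open>1..2 * N\<close>, since
    positions start at 1. A start \<open>a + 2 * N * u\<close> is then at most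
    \<open>2 * N * (u + 1)\<close>.\<close>
  define a t where "a = (i - 1) mod (2 * N) + 1" and "t = (i - 1) div (2 * N)"
  have NK: "2 ^ (k + 1) = 2 * N" "N > 0" by (auto simp: N_def)
  have K: "4 * N \<le> K" by (auto simp: K_def N_def)
  have ia: "i = a + 2 * N * t"
    using i mod_mult_div_eq[of "i - 1" "2 * N"] by (simp add: a_def t_def)
  have a: "1 \<le> a" "a \<le> 2 * N"
    using mod_less_divisor[of "2 * N" "i - 1"] NK(2) by (simp_all add: a_def Suc_le_eq)
  have vals: "f x = 1 \<or> f x = -1" for x
    using f by (auto simp: folding_instructions_def)
  have pvals: "paperfold f x = 1 \<or> paperfold f x = -1" for x
    using vals by (auto simp: paperfold_def Let_def)
  have "\<exists>u. a + 2 * N * u \<le> K \<and>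
    pf_word f (a + 2 * N * t) (a + 2 * N * t + n - 1) =
    pf_word f (a + 2 * N * u) (a + 2 * N * u + n - 1)"
  proof (cases "\<exists>c<n. N dvd a + c")
    case False
    then have "paperfold f (a + d + 2 * N * t) = paperfold f (a + d)" if "d < n" for d
      using paperfold_add_period[of k "a + d" f t] that by (auto simp: N_def)
    then have "pf_word f (a + 2 * N * t) (a + 2 * N * t + n - 1) = pf_word f a (a + n - 1)"
      unfolding pf_word_eq_iff[OF n(1)] by (simp add: ac_simps)
    then show ?thesis using a K by (intro exI[of _ 0]) auto
  next
    case True
    then obtain c j where c: "c < n" "a + c = N * j" unfolding dvd_def by blast
    have red: ?thesis if "a + 2 * N * u \<le> K"
      "paperfold f (N * j + 2 * N * t) = paperfold f (N * j + 2 * N * u)" for u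
      using pf_word_eq_shift[OF n c(1), of a f t u] that c(2) unfolding NK(1)
      by (auto simp: N_def[symmetric])
    \<comment> \<open>Here \<open>a + c \<le> 2 * N + (N - 1)\<close>, because
      \<open>c < n \<le> N\<close>.\<close>
    have "N * j < N * 3" "0 < N * j"
      using c a n unfolding N_def[symmetric] by linarith+
    then consider "j = 1" | "j = 2" by fastforce
    then show ?thesis
    proof cases
      case 1
      \<comment> \<open>The choices \<open>u = 0\<close> and \<open>u = 1\<close> realize both
        signs, with starts at most \<open>3 * N\<close>.\<close>
      have "a \<le> N" using c 1 by simp
      moreover have "paperfold f (N * j) = f k"
        using paperfold_one_mod_four[of f k 0] by (simp add: 1 N_def)
      moreover have "paperfold f (N * j + 2 * N * 1) = - f k"
        using paperfold_three_mod_four[of f k 0] by (simp add: 1 N_def mult.commute)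
      ultimately show ?thesis
        using red[of 0] red[of 1] pvals[of "N * j + 2 * N * t"] vals[of k] K by auto
    next
      case 2
      have v0: "paperfold f (N * j) = f (k + 1)"
        using paperfold_one_mod_four[of f "k + 1" 0] by (simp add: 2 N_def mult.commute)
      have v1: "paperfold f (N * j + 2 * N * 1) = f (k + 2)"
        using paperfold_one_mod_four[of f "k + 2" 0] by (simp add: 2 N_def mult.commute)
      have v2: "paperfold f (N * j + 2 * N * 2) = - f (k + 1)"
        using paperfold_three_mod_four[of f "k + 1" 0] by (simp add: 2 N_def mult.commute)
      \<comment> \<open>If \<open>f (k + 1) = f (k + 2)\<close>, then \<open>u = 1\<close> repeats
        the letter of \<open>u = 0\<close>; the opposite sign comes from \<open>u = 2\<close>, with
        start at most \<open>6 * N\<close>. Otherwise \<open>u = 1\<close> already supplies it, with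
        start at most \<open>4 * N\<close>.\<close>
      show ?thesis
      proof (cases "f (k + 1) = f (k + 2)")
        case True
        then have "K = 6 * N" by (simp add: K_def N_def)
        then show ?thesis
          using red[of 0] red[of 2] pvals[of "N * j + 2 * N * t"] vals[of "k + 1"] v0 v2 a by auto
      next
        case False
        then show ?thesis
          using red[of 0] red[of 1] pvals[of "N * j + 2 * N * t"]
            vals[of "k + 1"] vals[of "k + 2"] v0 v1 a K by auto
      qed
    qed
  qed
  then obtain u where "a + 2 * N * u \<le> K"
    "pf_word f i (i + n - 1) = pf_word f (a + 2 * N * u) (a + 2 * N * u + n - 1)"
    unfolding ia by blast
  then show ?thesis
    using a(1) unfolding K_def by (intro exI[of _ "a + 2 * N * u"]) auto
qed

text \<open>If 2 has exponent \<open>s \<le> k\<close> in \<open>i\<close>, one or two offsets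
  inside the window expose a letter of the wrong sign.\<close>

lemma paperfold_occurrence_synchronized:
  assumes f: "folding_instructions f" and k: "k \<ge> 2"
    and n: "n \<ge> 7" "2 ^ (k - 1) < n" and i: "i \<ge> 1"
    and eq: "\<And>d. d < n \<Longrightarrow> paperfold f (i + d) = paperfold f (2 ^ (k + 1) * q + d)"
  shows "2 ^ (k + 1) dvd i"
proof -
  have nz: "f x \<noteq> - f x" for x
    using f by (auto simp: folding_instructions_def dest: spec[of _ x])
  obtain s r where ir: "i = 2 ^ s * r" and r: "odd r"
    using i nat_eq_power_two_mult_odd[of i] by auto
  have "\<not> s \<le> k"
  proof
    assume s: "s \<le> k"
    show False
    proof (cases s)
      case 0
      \<comment> \<open>For odd \<open>i\<close> the offsets 2 and 6 are odd positions that agree modulo 4, whereas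
        after a multiple of 8 they carry the opposite letters \<open>f 1\<close> and \<open>- f 1\<close>.\<close>
      obtain e where e: "k = 2 + e" using k le_Suc_ex by blast
      have "odd i" using 0 ir r by simp
      then have "odd (i + 2)" "odd (i + 6)" "(i + 6) mod 4 = (i + 2) mod 4"
        by (simp_all, presburger)
      then have "paperfold f (i + 2) = paperfold f (i + 6)"
        using paperfold_power_mult_odd[of "i + 2" f 0] paperfold_power_mult_odd[of "i + 6" f 0]
        by simp
      moreover have "paperfold f (2 ^ (k + 1) * q + 2) = f 1"
        using paperfold_one_mod_four[of f 1 "2 ^ e * q"] by (simp add: e algebra_simps power_add)
      moreover have "paperfold f (2 ^ (k + 1) * q + 6) = - f 1"
        using paperfold_three_mod_four[of f 1 "2 ^ e * q"] by (simp add: e algebra_simps power_add)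
      ultimately show False using eq[of 2] eq[of 6] n nz[of 1] by simp
    next
      \<comment> \<open>The offset is half of \<open>2 ^ s\<close>:
        \<open>i + 2 ^ p = 2 ^ p * (2 * r + 1)\<close>, and \<open>2 * r + 1\<close> is 3 modulo 4
        as \<open>r\<close> is odd. After a multiple of \<open>2 ^ (k + 1)\<close> the cofactor of
        \<open>2 ^ p\<close> is 1 modulo 4 instead.\<close>
      case (Suc p)
      have "p \<le> k - 1" using s Suc by simp
      then have p: "2 ^ p < n"
        using n(2) power_increasing[of p "k - 1" "2::nat"] by linarith
      obtain e where e: "k = p + 1 + e" using s Suc le_Suc_ex[of "p + 1" k] by auto
      obtain v where "r = 2 * v + 1" using r by (auto elim: oddE)
      then have "paperfold f (i + 2 ^ p) = - f p"
        using paperfold_three_mod_four[of f p v] by (simp add: ir Suc algebra_simps)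
      moreover have "paperfold f (2 ^ (k + 1) * q + 2 ^ p) = f p"
        using paperfold_one_mod_four[of f p "2 ^ e * q"] by (simp add: e algebra_simps power_add)
      ultimately show False using eq[OF p] nz[of p] by simp
    qed
  qed
  then show ?thesis unfolding ir by (intro dvd_mult2 le_imp_power_dvd) simp
qed

theorem theorem3p4:
  fixes f :: "nat \<Rightarrow> int" and n k :: nat
  assumes "folding_instructions f"
    and "n \<ge> 7"
    and "phi n = 2 ^ k"
  shows "S_fun f n = (if f (k + 1) \<noteq> f (k + 2) then 4 * phi n else 6 * phi n)"
proof -
  define N :: nat where "N = 2 ^ k"
  define K where "K = (if f (k + 1) \<noteq> f (k + 2) then 4 * N else 6 * N)"
  have nN: "n \<le> 2 ^ k" by (rule phi_eq_powerD(1)[OF assms(3)])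
  have k: "k \<ge> 2"
  proof (rule ccontr)
    assume "\<not> k \<ge> 2"
    then have "(2::nat) ^ k \<le> 2 ^ 2" by (intro power_increasing) auto
    then show False using nN assms(2) by simp
  qed
  have n: "2 ^ (k - 1) < n" using phi_eq_powerD(2)[OF assms(3), of "k - 1"] k by simp
  have "S_fun f n = K"
    unfolding S_fun_def
  proof (rule Least_equality)
    show "\<forall>w\<in>pf_factors f n. \<exists>i. 1 \<le> i \<and> i \<le> K \<and> w = pf_word f i (i + n - 1)"
      using pf_word_recurs_early[OF assms(1) _ nN] assms(2)
      by (auto simp: pf_factors_def K_def N_def)
  next
    fix L
    assume L: "\<forall>w\<in>pf_factors f n. \<exists>i. 1 \<le> i \<and> i \<le> L \<and> w = pf_word f i (i + n - 1)"
    \<comment> \<open>The factor starting at \<open>K\<close> itself is the one that forces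
      \<open>L\<close> to be large.\<close>
    have "K \<ge> 1" by (simp add: K_def N_def)
    then have "pf_word f K (K + n - 1) \<in> pf_factors f n" by (auto simp: pf_factors_def)
    then obtain i where i: "1 \<le> i" "i \<le> L" "pf_word f K (K + n - 1) = pf_word f i (i + n - 1)"
      using L by blast
    have eq: "paperfold f (i + d) = paperfold f (K + d)" if "d < n" for d
      using i(3) that assms(2) pf_word_eq_iff[of n f K i] by auto
    obtain q where q: "K = 2 ^ (k + 1) * q"
      by (rule that[of "if f (k + 1) \<noteq> f (k + 2) then 2 else 3"]) (simp add: K_def N_def)
    have "2 ^ (k + 1) dvd i"
      using paperfold_occurrence_synchronized[OF assms(1) k assms(2) n i(1)] eq q by blast
    then obtain v where v: "i = 2 * N * v" by (auto simp: N_def elim: dvdE)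
    have P1: "paperfold f (2 * N) = f (k + 1)"
      using paperfold_one_mod_four[of f "k + 1" 0] by (simp add: N_def)
    have P2: "paperfold f (4 * N) = f (k + 2)"
      using paperfold_one_mod_four[of f "k + 2" 0] by (simp add: N_def)
    have P3: "paperfold f (6 * N) = - f (k + 1)"
      using paperfold_three_mod_four[of f "k + 1" 0] by (simp add: N_def mult.commute)
    have nz: "f (k + 1) \<noteq> - f (k + 1)"
      using assms(1) by (auto simp: folding_instructions_def dest: spec[of _ "k + 1"])
    have e0: "paperfold f i = paperfold f K" using eq[of 0] assms(2) by simp
    \<comment> \<open>Only first letters matter now: \<open>v = 1\<close> gives
      \<open>f (k + 1)\<close> and \<open>v = 2\<close> gives \<open>f (k + 2)\<close>, while
      \<open>K\<close> carries \<open>f (k + 2)\<close> when these differ and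
      \<open>- f (k + 1)\<close> when they agree.\<close>
    have "v \<noteq> 0" using v i(1) by auto
    moreover have "v \<noteq> 1"
      using e0 v P1 P2 P3 nz by (auto simp: K_def split: if_splits)
    moreover have "v \<noteq> 2" if "f (k + 1) = f (k + 2)"
      using e0 v P2 P3 nz that by (auto simp: K_def)
    ultimately have "(if f (k + 1) \<noteq> f (k + 2) then 2 else 3) \<le> v" by auto
    then have "2 * N * (if f (k + 1) \<noteq> f (k + 2) then 2 else 3) \<le> i"
      unfolding v by (rule mult_le_mono2)
    then show "K \<le> L" using i(2) by (auto simp: K_def split: if_splits)
  qed
  then show ?thesis by (simp add: K_def N_def assms(3))
qed

end
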